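(* Let $N\ge 1$, let $\mathbb{A}=\mathbb{Z}^N$, and let $f:\mathbb{Z}^N\to\mathbb{Z}$ be a nonzero map of finite functional degree. Then $$\mathrm{fdeg}^{\mathbb{A}}(f)=\mathrm{fdeg}^{\mathbb{Z}^N}(f).$$
   Context: For a map $f:\mathbb{Z}^N\to\mathbb{Z}$ and $a\in\mathbb{Z}^N$, $\Delta_a f(x)=f(x+a)-f(x)$. The map $f$ has finite functional degree if there is $d\in\mathbb{N}$ such that $\Delta_{a_1}\cdots\Delta_{a_{d+1}}f=0$ for all $a_1,\dots,a_{d+1}\in\mathbb{Z}^N$. Let $e_1,\dots,e_N$ be the standard basis of $\mathbb{Z}^N$. For $\underline{n}=(n_1,\dots,n_N)\in\mathbb{N}^N$ (with $0\in\mathbb{N}$), put $|\underline{n}|=n_1+\cdots+n_N$ and $\Delta^{\underline{n}}=\Delta_{e_1}^{n_1}\cdots\Delta_{e_N}^{n_N}$, where $\Delta_{e_i}^{n_i}$ is the $n_i$-fold composition of $\Delta_{e_i}$. Degree with respect to arbitrary differences ($\mathbb{A}=\mathbb{Z}^N$): $$\mathrm{fdeg}^{\mathbb{A}}(f)=\max\{d\in\mathbb{N}_{\ge1} : \Delta_{a_1}\cdots\Delta_{a_d}f\neq 0 \text{ for some } (a_1,\dots,a_d)\in\mathbb{A}^d\}.$$ Degree with respect to the standard basis differences: $$\mathrm{fdeg}^{\mathbb{Z}^N}(f)=\max\{|\underline{n}| : \underline{n}\in\mathbb{N}^N,\ |\underline{n}|\ge 1,\ \Delta^{\underline{n}}f\neq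 0\}.$$ By convention, for a nonzero constant function $f$ (where these sets are empty) both quantities are defined to be $1$. *)

theory Defs
  imports "HOL-Analysis.Finite_Cartesian_Product"
begin

definition fdiff :: "int ^ 'n \<Rightarrow> (int ^ 'n \<Rightarrow> int) \<Rightarrow> (int ^ 'n \<Rightarrow> int)"  ("\<Delta>")
  where "\<Delta> a f = (\<lambda>x. f (x + a) - f x)"

text \<open>For a list \<open>[a\<^sub>1, \<dots>, a\<^sub>d]\<close>, the term \<open>foldr \<Delta> [a\<^sub>1, \<dots>, a\<^sub>d] f\<close> is
  \<open>\<Delta> a\<^sub>1 (\<dots> (\<Delta> a\<^sub>d f))\<close>.\<close>

definition finite_functional_degree :: "(int ^ 'n \<Rightarrow> int) \<Rightarrow> bool"
  where "finite_functional_degree f \<longleftrightarrow>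
    (\<exists>d::nat. \<forall>as. length as = d + 1 \<longrightarrow> foldr \<Delta> as f = (\<lambda>_. 0))"

definition multi_size :: "nat ^ 'n \<Rightarrow> nat"
  where "multi_size n = (\<Sum>i\<in>UNIV. n $ i)"

text \<open>The composition of the operators \<open>\<Delta> (axis i 1) ^^ (n $ i)\<close> over all coordinates \<open>i\<close>.
  The index type carries no order, so the composition is a fold over a finite set; since the
  operators commute, every enumeration of the coordinates gives the same result
  (lemma \<open>fdiff_multi_eq_foldr\<close>).\<close>

definition fdiff_multi :: "nat ^ 'n \<Rightarrow> (int ^ 'n \<Rightarrow> int) \<Rightarrow> (int ^ 'n \<Rightarrow> int)"
  where "fdiff_multi n f = Finite_Set.fold (\<lambda>i. \<Delta> (axis i 1) ^^ (n $ i)) f UNIV"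

definition nonzero_constant :: "(int ^ 'n \<Rightarrow> int) \<Rightarrow> bool"
  where "nonzero_constant f \<longleftrightarrow> (\<exists>c. c \<noteq> 0 \<and> f = (\<lambda>_. c))"

definition arb_degrees :: "(int ^ 'n \<Rightarrow> int) \<Rightarrow> nat set"
  where "arb_degrees f = {d. d \<ge> 1 \<and> (\<exists>as. length as = d \<and> foldr \<Delta> as f \<noteq> (\<lambda>_. 0))}"

definition std_degrees :: "(int ^ 'n \<Rightarrow> int) \<Rightarrow> nat set"
  where "std_degrees f =
    {multi_size n |n. multi_size n \<ge> 1 \<and> fdiff_multi n f \<noteq> (\<lambda>_. 0)}"

text \<open>For \<open>f\<close> of finite functional degree both sets are finite (lemmas
  \<open>finite_arb_degrees\<close>, \<open>finite_std_degrees\<close>), so \<open>Max\<close> is the actual maximum unless the set is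
  empty, which happens only for constant \<open>f\<close>. For \<open>f = 0\<close> the value is unspecified.\<close>

definition fdeg_arb :: "(int ^ 'n \<Rightarrow> int) \<Rightarrow> nat"
  where "fdeg_arb f = (if nonzero_constant f then 1 else Max (arb_degrees f))"

definition fdeg_std :: "(int ^ 'n \<Rightarrow> int) \<Rightarrow> nat"
  where "fdeg_std f = (if nonzero_constant f then 1 else Max (std_degrees f))"

lemma fdiff_commute: "\<Delta> a (\<Delta> b f) = \<Delta> b (\<Delta> a f)"
  by (simp add: fdiff_def fun_eq_iff algebra_simps)

lemma funpow_fdiff_commute:
  "(\<Delta> a ^^ k) \<circ> (\<Delta> b ^^ l) = (\<Delta> b ^^ l) \<circ> (\<Delta> a ^^ k)"
proof -
  have "\<Delta> a ((\<Delta> b ^^ l) f) = (\<Delta> b ^^ l) (\<Delta> a f)" for f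
    by (induction l) (simp_all add: fdiff_commute[of a b])
  then have "(\<Delta> a ^^ k) ((\<Delta> b ^^ l) f) = (\<Delta> b ^^ l) ((\<Delta> a ^^ k) f)" for f
    by (induction k) simp_all
  then show ?thesis by (simp add: fun_eq_iff)
qed

lemma fdiff_multi_eq_foldr:
  fixes f :: "int ^ 'n \<Rightarrow> int"
  assumes "distinct is" "set is = (UNIV :: 'n set)"
  shows "fdiff_multi n f = foldr (\<lambda>i. \<Delta> (axis i 1) ^^ (n $ i)) is f"
proof -
  interpret comp_fun_commute "\<lambda>i::'n. \<Delta> (axis i 1) ^^ (n $ i)"
    by unfold_locales (rule funpow_fdiff_commute)
  have "Finite_Set.fold (\<lambda>i. \<Delta> (axis i 1) ^^ (n $ i)) f (set is)
      = foldr (\<lambda>i. \<Delta> (axis i 1) ^^ (n $ i)) is f"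
    using assms(1) by (induction "is") simp_all
  then show ?thesis by (simp add: fdiff_multi_def assms(2))
qed

lemma foldr_fdiff_zero: "foldr \<Delta> as (\<lambda>_. 0) = (\<lambda>_. 0)"
  by (induction as) (simp_all add: fdiff_def)

lemma finite_arb_degrees:
  assumes "finite_functional_degree f"
  shows "finite (arb_degrees f)"
proof -
  obtain d where d: "\<And>as. length as = d + 1 \<Longrightarrow> foldr \<Delta> as f = (\<lambda>_. 0)"
    using assms by (auto simp: finite_functional_degree_def)
  have "foldr \<Delta> as f = (\<lambda>_. 0)" if "length as > d" for as
  proof -
    let ?k = "length as - (d + 1)"
    have "foldr \<Delta> (take ?k as @ drop ?k as) f = (\<lambda>_. 0)"
      using that unfolding foldr_append o_apply by (subst d) (simp_all add: foldr_fdiff_zero)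
    then show ?thesis by simp
  qed
  then have "arb_degrees f \<subseteq> {..d}"
    by (auto simp: arb_degrees_def not_less[symmetric])
  then show ?thesis by (rule finite_subset) simp
qed

lemma fdiff_multi_eq_foldr_fdiff:
  fixes f :: "int ^ 'n \<Rightarrow> int"
  shows "\<exists>as. length as = multi_size n \<and> fdiff_multi n f = foldr \<Delta> as f"
proof -
  obtain js where js: "distinct js" "set js = (UNIV :: 'n set)"
    using finite_distinct_list[of "UNIV :: 'n set"] by auto
  define as :: "'n list \<Rightarrow> (int ^ 'n) list"
    where "as is = concat (map (\<lambda>i. replicate (n $ i) (axis i 1)) is)" for "is"
  have pow: "foldr \<Delta> (replicate k a) g = (\<Delta> a ^^ k) g" for k a and g :: "int ^ 'n \<Rightarrow> int"
    by (induction k) simp_all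
  have len: "length (as is) = sum_list (map (($) n) is)" for "is"
    by (induction "is") (simp_all add: as_def)
  have eq: "foldr (\<lambda>i. \<Delta> (axis i 1) ^^ (n $ i)) is f = foldr \<Delta> (as is) f" for "is"
    by (induction "is") (simp_all add: as_def pow)
  have "length (as js) = multi_size n"
    by (simp add: len multi_size_def js sum_list_distinct_conv_sum_set)
  moreover have "fdiff_multi n f = foldr \<Delta> (as js) f"
    by (simp only: fdiff_multi_eq_foldr[OF js] eq)
  ultimately show ?thesis by blast
qed

lemma std_degrees_subset: "std_degrees f \<subseteq> arb_degrees f"
proof
  fix d assume "d \<in> std_degrees f"
  then obtain n where n: "d = multi_size n" "d \<ge> 1" "fdiff_multi n f \<noteq> (\<lambda>_. 0)"
    unfolding std_degrees_def by blast
  obtain as where "length as = multi_size n" "fdiff_multi n f = foldr \<Delta> as f"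
    using fdiff_multi_eq_foldr_fdiff by blast
  with n show "d \<in> arb_degrees f"
    unfolding arb_degrees_def by (intro CollectI conjI exI[of _ as]) simp_all
qed

lemma finite_std_degrees: "finite_functional_degree f \<Longrightarrow> finite (std_degrees f)"
  by (rule finite_subset[OF std_degrees_subset finite_arb_degrees])

end

theory Submission
  imports Defs
begin

text \<open>A map killed by every \<open>\<Delta> e\<^sub>i\<close> is constant, because its periods form a subgroup. By induction
  on \<open>d\<close>, a map killed by all \<open>d\<close>-fold basis differences is therefore killed by all \<open>d\<close>-fold
  differences. So the two sets of degrees agree, not only their maxima.\<close>

lemma fdiff_eq_0_iff: "\<Delta> a g = (\<lambda>_. 0) \<longleftrightarrow> (\<forall>x. g (x + a) = g x)"
  by (simp add: fdiff_def fun_eq_iff)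

lemma fdiff_eq_0_add:
  assumes "\<Delta> a g = (\<lambda>_. 0)" "\<Delta> b g = (\<lambda>_. 0)"
  shows "\<Delta> (a + b) g = (\<lambda>_. 0)"
  using assms by (simp add: fdiff_eq_0_iff add.assoc[symmetric])

lemma fdiff_eq_0_uminus:
  assumes "\<Delta> a g = (\<lambda>_. 0)"
  shows "\<Delta> (- a) g = (\<lambda>_. 0)"
  unfolding fdiff_eq_0_iff
proof
  fix x
  have "g (x + - a + a) = g (x + - a)"
    using assms unfolding fdiff_eq_0_iff by blast
  then show "g (x + - a) = g x" by simp
qed

lemma fdiff_eq_0_sum:
  assumes "\<And>i. i \<in> I \<Longrightarrow> \<Delta> (v i) g = (\<lambda>_. 0)"
  shows "\<Delta> (\<Sum>i\<in>I. v i) g = (\<lambda>_. 0)"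
  using assms
proof (induction I rule: infinite_finite_induct)
  case (insert i I)
  then show ?case by (simp add: fdiff_eq_0_add)
qed (simp_all add: fdiff_def)

text \<open>The periods of \<open>g\<close> are closed under addition and negation, so they contain
  every integer multiple of \<open>axis i 1\<close>.\<close>

lemma fdiff_eq_0_axis:
  fixes g :: "int ^ 'n \<Rightarrow> int"
  assumes "\<Delta> (axis i 1) g = (\<lambda>_. 0)"
  shows "\<Delta> (axis i k) g = (\<lambda>_. 0)"
proof -
  have axis_nat: "\<Delta> (axis i (int m)) g = (\<lambda>_. 0)" for m
  proof (induction m)
    case 0
    have axis_0: "axis i (0 :: int) = 0" by (simp add: vec_eq_iff axis_def)
    show ?case by (simp add: fdiff_eq_0_iff axis_0)
  next
    case (Suc m)
    have "axis i (int (Suc m)) = axis i (int m) + axis i 1"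
      by (simp add: vec_eq_iff axis_def)
    with Suc assms show ?case by (simp add: fdiff_eq_0_add)
  qed
  have neg: "axis i (- int m) = - axis i (int m)" for m
    by (simp add: vec_eq_iff axis_def)
  show ?thesis
    by (cases k rule: int_cases2) (simp_all add: axis_nat neg fdiff_eq_0_uminus)
qed

lemma fdiff_eq_0_if_basis:
  fixes g :: "int ^ 'n \<Rightarrow> int"
  assumes "\<And>i. \<Delta> (axis i 1) g = (\<lambda>_. 0)"
  shows "\<Delta> a g = (\<lambda>_. 0)"
proof -
  have "a = (\<Sum>i\<in>UNIV. axis i (a $ i))"
    by (simp add: vec_eq_iff axis_def)
  then show ?thesis
    using fdiff_eq_0_sum[of UNIV "\<lambda>i. axis i (a $ i)" g] assms
    by (simp add: fdiff_eq_0_axis)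
qed

lemma foldr_fdiff_commute: "foldr \<Delta> as (\<Delta> b f) = \<Delta> b (foldr \<Delta> as f)"
  by (induction as) (simp_all add: fdiff_commute)

lemma foldr_fdiff_eq_0_if_basis:
  fixes f :: "int ^ 'n \<Rightarrow> int"
  assumes "\<And>is. length is = length as \<Longrightarrow> foldr \<Delta> (map (\<lambda>i. axis i 1) is) f = (\<lambda>_. 0)"
  shows "foldr \<Delta> as f = (\<lambda>_. 0)"
  using assms
proof (induction as arbitrary: f)
  case Nil
  then show ?case by simp
next
  case (Cons a as)
  have "foldr \<Delta> (map (\<lambda>i. axis i 1) is) (\<Delta> a f) = (\<lambda>_. 0)"
    if len: "length is = length as" for "is"
  proof -
    have "\<Delta> (axis i 1) (foldr \<Delta> (map (\<lambda>i. axis i 1) is) f) = (\<lambda>_. 0)" for i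
      using Cons.prems[of "i # is"] len by simp
    then show ?thesis
      \<comment> \<open>The basis difference of \<open>f\<close> along \<open>is\<close> has all
        \<open>axis i 1\<close> as periods, hence also \<open>a\<close>. Moving
        \<open>\<Delta> a\<close> inside turns this into the induction hypothesis for the map
        \<open>\<Delta> a f\<close>, which is why \<open>f\<close> is generalized.\<close>
      unfolding foldr_fdiff_commute by (rule fdiff_eq_0_if_basis)
  qed
  then have "foldr \<Delta> as (\<Delta> a f) = (\<lambda>_. 0)" by (rule Cons.IH)
  then show ?case by (simp add: foldr_fdiff_commute)
qed

text \<open>Only the factor at \<open>k\<close> gains a difference, and that one can be moved
  outermost since all differences commute.\<close>

lemma fdiff_multi_add_axis:
  fixes f :: "int ^ 'n \<Rightarrow> int"
  shows "fdiff_multi (n + axis k 1) f = \<Delta> (axis k 1) (fdiff_multi n f)"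
proof -
  let ?F = "\<lambda>(m :: nat ^ 'n) js. foldr (\<lambda>i. \<Delta> (axis i 1) ^^ (m $ i)) js f"
  obtain js where js: "distinct js" "set js = (UNIV :: 'n set)"
    using finite_distinct_list[of "UNIV :: 'n set"] by auto
  have pow: "(\<Delta> a ^^ m) (\<Delta> b g) = \<Delta> b ((\<Delta> a ^^ m) g)" for a b m and g :: "int ^ 'n \<Rightarrow> int"
    by (induction m) (simp_all add: fdiff_commute)
  \<comment> \<open>The induction runs through lists that do not contain \<open>k\<close>, hence the
    case distinction; distinctness makes the factor at \<open>k\<close> occur at most once.\<close>
  have "?F (n + axis k 1) js = (if k \<in> set js then \<Delta> (axis k 1) (?F n js) else ?F n js)"
    using js(1) by (induction js) (auto simp: axis_def pow)
  then show ?thesis by (simp add: fdiff_multi_eq_foldr[OF js] js)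
qed

text \<open>The witness \<open>n\<close> counts how often each index occurs in \<open>is\<close>; it
  is built up by adding \<open>axis i 1\<close> for every entry \<open>i\<close>.\<close>

lemma foldr_fdiff_basis_eq_fdiff_multi:
  fixes f :: "int ^ 'n \<Rightarrow> int"
  shows "\<exists>n. multi_size n = length is
    \<and> fdiff_multi n f = foldr \<Delta> (map (\<lambda>i. axis i 1) is) f"
proof (induction "is")
  case Nil
  have "multi_size (0 :: nat ^ 'n) = 0" by (simp add: multi_size_def)
  \<comment> \<open>A list of differences of length \<open>multi_size 0 = 0\<close> is
    empty.\<close>
  moreover from this have "fdiff_multi 0 f = f"
    using fdiff_multi_eq_foldr_fdiff[of "0 :: nat ^ 'n" f] by auto
  ultimately show ?case by (intro exI[of _ 0]) simp
next
  case (Cons i "is")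
  then obtain n where n: "multi_size n = length is"
    "fdiff_multi n f = foldr \<Delta> (map (\<lambda>i. axis i 1) is) f" by blast
  have "multi_size (n + axis i 1) = Suc (multi_size n)"
    by (simp add: multi_size_def sum.distrib axis_def)
  with n show ?case
    by (intro exI[of _ "n + axis i 1"]) (simp add: fdiff_multi_add_axis del: One_nat_def)
qed

lemma std_degrees_eq_arb_degrees: "std_degrees f = arb_degrees f"
proof (rule equalityI[OF std_degrees_subset subsetI])
  fix d assume "d \<in> arb_degrees f"
  then obtain as where as: "length as = d" "d \<ge> 1" "foldr \<Delta> as f \<noteq> (\<lambda>_. 0)"
    by (auto simp: arb_degrees_def)
  then obtain "is" where "length is = d" "foldr \<Delta> (map (\<lambda>i. axis i 1) is) f \<noteq> (\<lambda>_. 0)"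
    \<comment> \<open>By contraposition: if all basis differences of length \<open>d\<close>
      vanished, so would the one along \<open>as\<close>.\<close>
    using foldr_fdiff_eq_0_if_basis[of as f] by blast
  then obtain n where "multi_size n = d" "fdiff_multi n f \<noteq> (\<lambda>_. 0)"
    using foldr_fdiff_basis_eq_fdiff_multi[of "is" f] by auto
  with as(2) show "d \<in> std_degrees f"
    unfolding std_degrees_def by blast
qed

theorem theorem2p2:
  fixes f :: "int ^ 'n \<Rightarrow> int"
  assumes "f \<noteq> (\<lambda>_. 0)"
    and "finite_functional_degree f"
  shows "fdeg_arb f = fdeg_std f"
  by (simp add: fdeg_arb_def fdeg_std_def std_degrees_eq_arb_degrees)

end
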